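(* Let $G,I,J,L,M,N,P,Q,R,S$ be complex numbers and put $$\begin{aligned} A&=I+2L+2N+P+2Q+6R+4S-14,\\ D&=-G-I-J-2L-M-2P-3Q-6R-7S+20,\\ E&=-I-2L-N-Q-3R-S+5,\\ F&=-3G-6I-7J-7M+6N-12L-9P-15Q-24R-33S+90,\\ H&=-L-2N-P-Q-4R-3S+10,\\ K&=2I+2J-2N+4L-P+4Q+6R+2S-10, \end{aligned}$$ and assume $D\ne0$. Then for all integers $m\ge0$ and $n\ge1$, $$\begin{aligned} D\,t_{5,m}^{(n)}&=\frac1{(A_1^{(n)})^5}\sum_{k_1+\cdots+k_5=m}\binom{m}{k_1,\dots,k_5}U_{k_1}^{(n)}\cdots U_{k_5}^{(n)}\\ &\quad-\frac{A}{A_1^{(5n)}}5^mU_m^{(5n)}-\frac{E}{A_1^{(4n)}A_1^{(n)}}\sum_{k=0}^m\binom mk4^{m-k}U_{m-k}^{(4n)}U_k^{(n)}-F\left(\frac{-1}{563}\right)^n\sum_{k=0}^m\binom mkU_k^{(n)}\\ &\quad-\frac{G}{A_1^{(n)}}\sum_{k=0}^m\binom mkt_{2,k}^{(n)}U_{m-k}^{(n)}-\frac{H}{A_1^{(3n)}A_1^{(2n)}}\sum_{k=0}^m\binom mk3^{m-k}2^kU_{m-k}^{(3n)}U_k^{(2n)}\\ &\quad-\frac{I}{A_1^{(3n)}}\sum_{k=0}^m\binom mk3^kU_k^{(3n)}t_{1,m-k}^{(n)}\\ &\quad-\frac{J}{A_2^{(n)}A_1^{(2n)}}\sum_{k_1+k_2+k_3=m}\binom{m}{k_1,k_2,k_3}(-1)^{k_1}V_{k_1}^{(n)}2^{k_2}U_{k_2}^{(2n)}\\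 &\quad-\frac{K}{A_2^{(n)}}\sum_{k_1+k_2+k_3=m}\binom{m}{k_1,k_2,k_3}(-1)^{k_1}V_{k_1}^{(n)}t_{1,k_2}^{(n)}\\ &\quad-\frac{L}{A_1^{(3n)}(A_1^{(n)})^2}\sum_{k_1+k_2+k_3=m}\binom{m}{k_1,k_2,k_3}3^{k_1}U_{k_1}^{(3n)}U_{k_2}^{(n)}U_{k_3}^{(n)}\\ &\quad-\frac{M}{A_2^{(n)}(A_1^{(n)})^2}\sum_{k_1+k_2+k_3+k_4=m}\binom{m}{k_1,k_2,k_3,k_4}(-1)^{k_1}V_{k_1}^{(n)}U_{k_2}^{(n)}U_{k_3}^{(n)}\\ &\quad-\frac{N}{(A_1^{(2n)})^2A_1^{(n)}}\sum_{k_1+k_2+k_3=m}\binom{m}{k_1,k_2,k_3}2^{k_1}U_{k_1}^{(2n)}2^{k_2}U_{k_2}^{(2n)}U_{k_3}^{(n)}\\ &\quad-\frac{P}{A_1^{(n)}}\sum_{k_1+k_2+k_3=m}\binom{m}{k_1,k_2,k_3}t_{1,k_1}^{(n)}t_{1,k_2}^{(n)}U_{k_3}^{(n)}\\ &\quad-\frac{Q}{A_1^{(2n)}A_1^{(n)}}\sum_{k_1+k_2+k_3=m}\binom{m}{k_1,k_2,k_3}2^{k_1}U_{k_1}^{(2n)}t_{1,k_2}^{(n)}U_{k_3}^{(n)}\\ &\quad-\frac{R}{A_1^{(2n)}(A_1^{(n)})^3}\sum_{k_1+k_2+k_3+k_4=m}\binom{m}{k_1,k_2,k_3,k_4}2^{k_1}U_{k_1}^{(2n)}U_{k_2}^{(n)}U_{k_3}^{(n)}U_{k_4}^{(n)}\\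 &\quad-\frac{S}{(A_1^{(n)})^3}\sum_{k_1+k_2+k_3+k_4=m}\binom{m}{k_1,k_2,k_3,k_4}t_{1,k_1}^{(n)}U_{k_2}^{(n)}U_{k_3}^{(n)}U_{k_4}^{(n)}. \end{aligned}$$
   Context: Let $\lambda_1,\lambda_2,\lambda_3,\lambda_4$ be the (distinct, complex) roots of $x^4-x^3-x^2-x-1=0$ and $c_i=\frac1{-\lambda_i^3+6\lambda_i-1}$. A Tetranacci-type sequence is one in which, from index $4$ on, each term is the sum of the four preceding terms. For each $n\ge1$, let $A_1^{(n)}$ be the nonzero rational number and $U_k^{(n)}=T_{1,k}^{(s_{1,0}^{(n)},s_{1,1}^{(n)},s_{1,2}^{(n)},s_{1,3}^{(n)})}$ the Tetranacci-type sequence with integer initial values $U_j^{(n)}=s_{1,j}^{(n)}$ ($0\le j\le3$) of greatest common divisor $1$ such that $$\sum_{i=1}^4c_i^ne^{\lambda_ix}=\frac1{A_1^{(n)}}\sum_{k=0}^\infty U_k^{(n)}\frac{x^k}{k!}.$$ Likewise let $A_2^{(n)}$ be the nonzero rational number and $V_k^{(n)}=T_{2,k}^{(s_{2,0}^{(n)},s_{2,1}^{(n)},s_{2,2}^{(n)},s_{2,3}^{(n)})}$ the Tetranacci-type sequence with integer initial values $V_j^{(n)}=s_{2,j}^{(n)}$ ($0\le j\le3$) of greatest common divisor $1$ such that $$\sum_{i=1}^4\Big(\prod_{j\ne i}c_j^n\Big)e^{\lambda_ix}=\frac1{A_2^{(n)}}\sum_{k=0}^\infty V_k^{(n)}\frac{x^k}{k!}.$$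 The signs are fixed by requiring $U_k^{(n)}>0$ and $V_k^{(n)}>0$ for all sufficiently large $k$. Put $$t_{1,m}^{(n)}=\frac12\left(\frac1{(A_1^{(n)})^2}\sum_{k=0}^m\binom mkU_k^{(n)}U_{m-k}^{(n)}-\frac{2^m}{A_1^{(2n)}}U_m^{(2n)}\right),$$ equivalently $\sum_{m\ge0}t_{1,m}^{(n)}\frac{x^m}{m!}=\sum_{1\le i<j\le4}c_i^nc_j^ne^{(\lambda_i+\lambda_j)x}$, and define $t_{2,m}^{(n)}$, $t_{5,m}^{(n)}$ by $$\sum_{m=0}^\infty t_{2,m}^{(n)}\frac{x^m}{m!}=\sum_{1\le i<j<l\le4}c_i^nc_j^nc_l^ne^{(\lambda_i+\lambda_j+\lambda_l)x}\left(c_i^ne^{\lambda_ix}+c_j^ne^{\lambda_jx}+c_l^ne^{\lambda_lx}\right),$$ $$\sum_{m=0}^\infty t_{5,m}^{(n)}\frac{x^m}{m!}=\sum_{1\le i<j<l\le4}c_i^nc_j^nc_l^ne^{(\lambda_i+\lambda_j+\lambda_l)x}\left(c_i^ne^{\lambda_ix}+c_j^ne^{\lambda_jx}+c_l^ne^{\lambda_lx}\right)^2.$$ Superscripts $(n)$ are indices; $c_i^n$ is an $n$-th power. All indices $k_i$ run over nonnegative integers and $\binom{m}{k_1,\dots,k_r}=\frac{m!}{k_1!\cdots k_r!}$.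
   Formalization: The F-term is corrected to -(F/A_1^{(n)})(-1/563)^n Σ binom(m,k)U_k^{(n)}; the printed term lacks the factor 1/A_1^{(n)} and makes the identity false, e.g. for n=2, m=0 and all ten parameters 0, where A_1^{(2)}=563. *)

theory Defs
  imports "HOL-Analysis.Analysis" "HOL-Computational_Algebra.Formal_Power_Series"
begin

definition tetranacci_roots :: "(nat \<Rightarrow> complex) \<Rightarrow> bool" where
  "tetranacci_roots lam \<longleftrightarrow>
     bij_betw lam {1..4} {x. x ^ 4 - x ^ 3 - x ^ 2 - x - 1 = 0}"

definition cf :: "(nat \<Rightarrow> complex) \<Rightarrow> nat \<Rightarrow> complex" where
  "cf lam i = 1 / (- (lam i ^ 3) + 6 * lam i - 1)"

definition tetranacci_type :: "(nat \<Rightarrow> int) \<Rightarrow> bool" where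
  "tetranacci_type u \<longleftrightarrow>
     (\<forall>k\<ge>4. u k = u (k - 1) + u (k - 2) + u (k - 3) + u (k - 4))"

text \<open>Exponential generating functions are read as formal power series, with
  \<^const>\<open>fps_exp\<close> for \<open>e\<^sup>\<lambda>\<^sup>x\<close>.\<close>

definition egf :: "(nat \<Rightarrow> complex) \<Rightarrow> complex fps" where
  "egf u = Abs_fps (\<lambda>k. u k / fact k)"

text \<open>The sequence having a given exponential generating function, i.e. the inverse of
  \<^const>\<open>egf\<close>.\<close>

definition egf_coeff :: "complex fps \<Rightarrow> nat \<Rightarrow> complex" where
  "egf_coeff f m = fact m * fps_nth f m"

definition primitive_tetranacci_rep :: "complex fps \<Rightarrow> rat \<Rightarrow> (nat \<Rightarrow> int) \<Rightarrow> bool" where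
  "primitive_tetranacci_rep f a u \<longleftrightarrow>
     a \<noteq> 0 \<and> tetranacci_type u \<and> Gcd (u ` {0..3}) = 1 \<and>
     (\<forall>\<^sub>F k in sequentially. u k > 0) \<and>
     f = fps_const (1 / of_rat a) * egf (\<lambda>k. of_int (u k))"

definition gf1 :: "(nat \<Rightarrow> complex) \<Rightarrow> nat \<Rightarrow> complex fps" where
  "gf1 lam n = (\<Sum>i=1..4. fps_const (cf lam i ^ n) * fps_exp (lam i))"

definition gf2 :: "(nat \<Rightarrow> complex) \<Rightarrow> nat \<Rightarrow> complex fps" where
  "gf2 lam n = (\<Sum>i=1..4. fps_const (\<Prod>j\<in>{1..4} - {i}. cf lam j ^ n) * fps_exp (lam i))"

definition t1 :: "(nat \<Rightarrow> rat) \<Rightarrow> (nat \<Rightarrow> nat \<Rightarrow> int) \<Rightarrow> nat \<Rightarrow> nat \<Rightarrow> complex" where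
  "t1 A1 U n m =
     1 / 2 * (1 / of_rat (A1 n) ^ 2 *
                (\<Sum>k=0..m. of_nat (m choose k) * of_int (U n k) * of_int (U n (m - k)))
              - 2 ^ m / of_rat (A1 (2 * n)) * of_int (U (2 * n) m))"

definition t2 :: "(nat \<Rightarrow> complex) \<Rightarrow> nat \<Rightarrow> nat \<Rightarrow> complex" where
  "t2 lam n = egf_coeff
     (\<Sum>(i, j, l) \<in> {(i, j, l). 1 \<le> i \<and> i < j \<and> j < l \<and> l \<le> 4}.
        fps_const (cf lam i ^ n * cf lam j ^ n * cf lam l ^ n) * fps_exp (lam i + lam j + lam l) *
        (fps_const (cf lam i ^ n) * fps_exp (lam i) + fps_const (cf lam j ^ n) * fps_exp (lam j)
         + fps_const (cf lam l ^ n) * fps_exp (lam l)))"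

definition t5 :: "(nat \<Rightarrow> complex) \<Rightarrow> nat \<Rightarrow> nat \<Rightarrow> complex" where
  "t5 lam n = egf_coeff
     (\<Sum>(i, j, l) \<in> {(i, j, l). 1 \<le> i \<and> i < j \<and> j < l \<and> l \<le> 4}.
        fps_const (cf lam i ^ n * cf lam j ^ n * cf lam l ^ n) * fps_exp (lam i + lam j + lam l) *
        (fps_const (cf lam i ^ n) * fps_exp (lam i) + fps_const (cf lam j ^ n) * fps_exp (lam j)
         + fps_const (cf lam l ^ n) * fps_exp (lam l)) ^ 2)"

definition multinomial :: "nat \<Rightarrow> nat list \<Rightarrow> complex" where
  "multinomial m ks = fact m / prod_list (map fact ks)"

end

theory Submission
  imports Defs
begin

text \<open>
  Fix \<open>n\<close> and put \<open>a\<^sub>i = c\<^sub>i\<^sup>n e\<^bsup>\<lambda>\<^sub>i x\<^esup>\<close>. Read as exponential generating functions, all the sequences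
  in the theorem are symmetric functions of \<open>a\<^sub>1, \<dots>, a\<^sub>4\<close>, and multinomial convolutions of
  sequences are products of these functions. Write \<open>p\<^sub>r\<close> for the power sums and \<open>e\<^sub>r\<close> for the
  elementary symmetric functions of the \<open>a\<^sub>i\<close>.

  \<^item> As \<open>a\<^sub>i\<^sup>r = c\<^sub>i\<^bsup>rn\<^esup> e\<^bsup>r\<lambda>\<^sub>i x\<^esup>\<close>, the sequence \<open>r\<^sup>k U\<^sub>k\<close> of index \<open>rn\<close>, divided by its \<open>A\<^sub>1\<close>,
    belongs to \<open>p\<^sub>r\<close> (\<open>egf_coeff_power_sum\<close>); hence \<open>t\<^sub>1\<close> belongs to \<open>(p\<^sub>1\<^sup>2 - p\<^sub>2) / 2 = e\<^sub>2\<close>.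
  \<^item> The roots have sum 1 (\<open>root_relations\<close>), so multiplying the terms \<open>e\<^bsup>-\<lambda>\<^sub>i x\<^esup>\<close> by \<open>e\<^sup>x\<close> gives the
    exponentials of the sums of three roots. Therefore \<open>(-1)\<^sup>k V\<^sub>k / A\<^sub>2\<close>, convolved with the
    constant sequence 1, belongs to \<open>e\<^sub>3\<close> (\<open>elementary3_eq\<close>). This constant sequence is the
    source of the one summation index in the terms with \<open>V\<close> that occurs in the multinomial
    coefficient only.
  \<^item> The product of the \<open>c\<^sub>i\<close> is \<open>-1/563\<close> (\<open>prod_cf\<close>), so \<open>e\<^sub>4 = (-1/563)\<^sup>n e\<^sup>x\<close>
    (\<open>elementary4_eq\<close>).

  After this translation the theorem says that the coefficients of \<open>x\<^sup>m\<close> agree in an identity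
  between symmetric polynomials of degree 5 in four variables. Newton's identities turn it into
  an identity in \<open>p\<^sub>1, e\<^sub>2, e\<^sub>3, e\<^sub>4\<close>, and the values of \<open>A, D, E, F, H, K\<close> are those for which the
  coefficients of the six monomials of weight 5 cancel (\<open>symmetric_identity\<close>).
\<close>

section \<open>Products of exponential generating functions\<close>

text \<open>The inductive step for products of several series: when the coefficients of \<open>h\<close> are sums over
  compositions of \<open>j\<close> (the elements of \<open>B j\<close>), those of \<open>f * h\<close> are sums over compositions with one
  more part.\<close>
lemma fps_nth_mult_sum:
  fixes f h :: "'a::comm_ring_1 fps"
  assumes fin: "\<And>j. finite (B j)" and h: "\<And>j. fps_nth h j = (\<Sum>y\<in>B j. w y)"
  shows "fps_nth (f * h) m = (\<Sum>(k, y)\<in>{(k, y). k \<le> m \<and> y \<in> B (m - k)}. fps_nth f k * w y)"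
proof -
  have "fps_nth (f * h) m = (\<Sum>k\<in>{0..m}. \<Sum>y\<in>B (m - k). fps_nth f k * w y)"
    by (simp add: fps_mult_nth h sum_distrib_left)
  also have "\<dots> = (\<Sum>(k, y)\<in>(SIGMA k:{0..m}. B (m - k)). fps_nth f k * w y)"
    by (rule sum.Sigma) (auto simp: fin)
  also have "(SIGMA k:{0..m}. B (m - k)) = {(k, y). k \<le> m \<and> y \<in> B (m - k)}"
    by auto
  finally show ?thesis .
qed

lemma finite_compositions:
  fixes m :: nat
  shows "finite {(k1, k2). k1 + k2 = m}"
    and "finite {(k1, k2, k3). k1 + k2 + k3 = m}"
    and "finite {(k1, k2, k3, k4). k1 + k2 + k3 + k4 = m}"
proof -
  show "finite {(k1, k2). k1 + k2 = m}"
    by (rule finite_subset[of _ "{0..m} \<times> {0..m}"]) auto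
  show "finite {(k1, k2, k3). k1 + k2 + k3 = m}"
    by (rule finite_subset[of _ "{0..m} \<times> {0..m} \<times> {0..m}"]) auto
  show "finite {(k1, k2, k3, k4). k1 + k2 + k3 + k4 = m}"
    by (rule finite_subset[of _ "{0..m} \<times> {0..m} \<times> {0..m} \<times> {0..m}"]) auto
qed

lemma fps_nth_mult2:
  fixes f g :: "'a::comm_ring_1 fps"
  shows "fps_nth (f * g) m = (\<Sum>(k1, k2)\<in>{(k1, k2). k1 + k2 = m}. fps_nth f k1 * fps_nth g k2)"
proof -
  have "fps_nth (f * g) m
      = (\<Sum>(k, y)\<in>{(k, y). k \<le> m \<and> y \<in> {m - k}}. fps_nth f k * fps_nth g y)"
    by (rule fps_nth_mult_sum) auto
  also have "{(k, y). k \<le> m \<and> y \<in> {m - k}} = {(k1, k2). k1 + k2 = m}"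
    by auto
  finally show ?thesis .
qed

lemma fps_nth_mult3:
  fixes f g h :: "'a::comm_ring_1 fps"
  shows "fps_nth (f * g * h) m = (\<Sum>(k1, k2, k3)\<in>{(k1, k2, k3). k1 + k2 + k3 = m}.
    fps_nth f k1 * (fps_nth g k2 * fps_nth h k3))"
proof -
  have "fps_nth (f * (g * h)) m = (\<Sum>(k, y)\<in>{(k, y). k \<le> m \<and> y \<in> {(k2, k3). k2 + k3 = m - k}}.
      fps_nth f k * (case y of (k2, k3) \<Rightarrow> fps_nth g k2 * fps_nth h k3))"
    by (rule fps_nth_mult_sum) (auto simp: fps_nth_mult2 finite_compositions)
  also have "{(k, y). k \<le> m \<and> y \<in> {(k2, k3). k2 + k3 = m - k}}
      = {(k1, k2, k3). k1 + k2 + k3 = m}"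
    by auto
  finally show ?thesis by (simp add: case_prod_unfold mult.assoc)
qed

lemma fps_nth_mult4:
  fixes f1 f2 f3 f4 :: "'a::comm_ring_1 fps"
  shows "fps_nth (f1 * f2 * f3 * f4) m =
    (\<Sum>(k1, k2, k3, k4)\<in>{(k1, k2, k3, k4). k1 + k2 + k3 + k4 = m}.
      fps_nth f1 k1 * (fps_nth f2 k2 * (fps_nth f3 k3 * fps_nth f4 k4)))"
proof -
  have "fps_nth (f1 * (f2 * f3 * f4)) m =
      (\<Sum>(k, y)\<in>{(k, y). k \<le> m \<and> y \<in> {(k2, k3, k4). k2 + k3 + k4 = m - k}}.
      fps_nth f1 k * (case y of (k2, k3, k4) \<Rightarrow> fps_nth f2 k2 * (fps_nth f3 k3 * fps_nth f4 k4)))"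
    by (rule fps_nth_mult_sum) (simp_all only: fps_nth_mult3 finite_compositions)
  also have "{(k, y). k \<le> m \<and> y \<in> {(k2, k3, k4). k2 + k3 + k4 = m - k}}
      = {(k1, k2, k3, k4). k1 + k2 + k3 + k4 = m}"
    by auto
  finally show ?thesis by (simp add: case_prod_unfold mult.assoc)
qed

lemma fps_nth_mult5:
  fixes f1 f2 f3 f4 f5 :: "'a::comm_ring_1 fps"
  shows "fps_nth (f1 * f2 * f3 * f4 * f5) m =
    (\<Sum>(k1, k2, k3, k4, k5)\<in>{(k1, k2, k3, k4, k5). k1 + k2 + k3 + k4 + k5 = m}.
      fps_nth f1 k1 * (fps_nth f2 k2 * (fps_nth f3 k3 * (fps_nth f4 k4 * fps_nth f5 k5))))"
proof -
  have "fps_nth (f1 * (f2 * f3 * f4 * f5)) m =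
      (\<Sum>(k, y)\<in>{(k, y). k \<le> m \<and> y \<in> {(k2, k3, k4, k5). k2 + k3 + k4 + k5 = m - k}}.
      fps_nth f1 k * (case y of (k2, k3, k4, k5) \<Rightarrow>
        fps_nth f2 k2 * (fps_nth f3 k3 * (fps_nth f4 k4 * fps_nth f5 k5))))"
    by (rule fps_nth_mult_sum) (simp_all only: fps_nth_mult4 finite_compositions)
  also have "{(k, y). k \<le> m \<and> y \<in> {(k2, k3, k4, k5). k2 + k3 + k4 + k5 = m - k}}
      = {(k1, k2, k3, k4, k5). k1 + k2 + k3 + k4 + k5 = m}"
    by auto
  finally show ?thesis by (simp add: case_prod_unfold mult.assoc)
qed

lemma egf_coeff_mult2:
  "egf_coeff (f * g) m =
     (\<Sum>k=0..m. of_nat (m choose k) * egf_coeff f k * egf_coeff g (m - k))"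
  unfolding egf_coeff_def fps_mult_nth sum_distrib_left
  by (intro sum.cong refl) (simp add: binomial_fact field_simps)

lemma egf_coeff_mult3:
  "egf_coeff (f1 * f2 * f3) m = (\<Sum>(k1, k2, k3)\<in>{(k1, k2, k3). k1 + k2 + k3 = m}.
     multinomial m [k1, k2, k3] * egf_coeff f1 k1 * egf_coeff f2 k2 * egf_coeff f3 k3)"
  unfolding egf_coeff_def fps_nth_mult3 sum_distrib_left
  by (intro sum.cong refl) (auto simp: multinomial_def field_simps)

lemma egf_coeff_mult4:
  "egf_coeff (f1 * f2 * f3 * f4) m =
   (\<Sum>(k1, k2, k3, k4)\<in>{(k1, k2, k3, k4). k1 + k2 + k3 + k4 = m}.
     multinomial m [k1, k2, k3, k4] * egf_coeff f1 k1 * egf_coeff f2 k2 * egf_coeff f3 k3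
       * egf_coeff f4 k4)"
  unfolding egf_coeff_def fps_nth_mult4 sum_distrib_left
  by (intro sum.cong refl) (auto simp: multinomial_def field_simps)

lemma egf_coeff_mult5:
  "egf_coeff (f1 * f2 * f3 * f4 * f5) m =
   (\<Sum>(k1, k2, k3, k4, k5)\<in>{(k1, k2, k3, k4, k5). k1 + k2 + k3 + k4 + k5 = m}.
     multinomial m [k1, k2, k3, k4, k5] * egf_coeff f1 k1 * egf_coeff f2 k2 * egf_coeff f3 k3
       * egf_coeff f4 k4 * egf_coeff f5 k5)"
  unfolding egf_coeff_def fps_nth_mult5 sum_distrib_left
  by (intro sum.cong refl) (auto simp: multinomial_def field_simps)

lemma egf_coeff_linear:
  "egf_coeff (f + g) m = egf_coeff f m + egf_coeff g m"
  "egf_coeff (f - g) m = egf_coeff f m - egf_coeff g m"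
  "egf_coeff (fps_const c * f) m = c * egf_coeff f m"
  by (simp_all add: egf_coeff_def algebra_simps)

lemma egf_coeff_rep:
  assumes "primitive_tetranacci_rep f a u"
  shows "egf_coeff f k = of_int (u k) / of_rat a"
  using assms by (simp add: primitive_tetranacci_rep_def egf_coeff_def egf_def)

section \<open>The roots of the Tetranacci polynomial\<close>

text \<open>Vieta's formulas. The divided differences of the polynomial at two, three and four of the roots
  vanish because the roots are distinct; the one at all four roots is \<open>a + b + c + d - 1\<close>.\<close>
lemma vieta:
  fixes a b c d :: complex
  assumes distinct: "a \<noteq> b" "a \<noteq> c" "a \<noteq> d" "b \<noteq> c" "b \<noteq> d" "c \<noteq> d"
    and root: "a^4 - a^3 - a^2 - a - 1 = 0" "b^4 - b^3 - b^2 - b - 1 = 0"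
      "c^4 - c^3 - c^2 - c - 1 = 0" "d^4 - d^3 - d^2 - d - 1 = 0"
  shows "a + b + c + d = 1"
    and "a*b + a*c + a*d + b*c + b*d + c*d = -1"
    and "a*b*c + a*b*d + a*c*d + b*c*d = 1"
    and "a*b*c*d = -1"
proof -
  have q: "x^3 + x^2*y + x*y^2 + y^3 - (x^2 + x*y + y^2) - (x + y) - 1 = 0"
    if "x \<noteq> y" "x^4 - x^3 - x^2 - x - 1 = 0" "y^4 - y^3 - y^2 - y - 1 = 0" for x y :: complex
  proof -
    have "(x - y) * (x^3 + x^2*y + x*y^2 + y^3 - (x^2 + x*y + y^2) - (x + y) - 1) = 0"
      using that(2,3) by algebra
    then show ?thesis using that(1) by simp
  qed
  have ab: "a^3 + a^2*b + a*b^2 + b^3 - (a^2 + a*b + b^2) - (a + b) - 1 = 0"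
    using q distinct root by blast
  have ac: "a^3 + a^2*c + a*c^2 + c^3 - (a^2 + a*c + c^2) - (a + c) - 1 = 0"
    using q distinct root by blast
  have ad: "a^3 + a^2*d + a*d^2 + d^3 - (a^2 + a*d + d^2) - (a + d) - 1 = 0"
    using q distinct root by blast
  have "(b - c) * (a^2 + b^2 + c^2 + a*b + a*c + b*c - (a + b + c) - 1) = 0"
    using ab ac by algebra
  then have abc: "a^2 + b^2 + c^2 + a*b + a*c + b*c - (a + b + c) - 1 = 0"
    using distinct by simp
  have "(b - d) * (a^2 + b^2 + d^2 + a*b + a*d + b*d - (a + b + d) - 1) = 0"
    using ab ad by algebra
  then have abd: "a^2 + b^2 + d^2 + a*b + a*d + b*d - (a + b + d) - 1 = 0"
    using distinct by simp
  have "(c - d) * (a + b + c + d - 1) = 0"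
    using abc abd by algebra
  then have e1: "a + b + c + d = 1"
    using distinct by simp
  have d_eq: "d = 1 - a - b - c" using e1 by algebra
  show "a + b + c + d = 1" by (fact e1)
  show e2: "a*b + a*c + a*d + b*c + b*d + c*d = -1"
    using abc d_eq by algebra
  show e3: "a*b*c + a*b*d + a*c*d + b*c*d = 1"
    using ab abc e1 by algebra
  show "a*b*c*d = -1"
    using root(1) e1 e2 e3 by algebra
qed

lemma root_relations:
  assumes "tetranacci_roots lam"
  shows "lam 1 + lam 2 + lam 3 + lam 4 = 1"
    and "lam 1*lam 2 + lam 1*lam 3 + lam 1*lam 4 + lam 2*lam 3 + lam 2*lam 4 + lam 3*lam 4 = -1"
    and "lam 1*lam 2*lam 3 + lam 1*lam 2*lam 4 + lam 1*lam 3*lam 4 + lam 2*lam 3*lam 4 = 1"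
    and "lam 1*lam 2*lam 3*lam 4 = -1"
proof -
  have inj: "inj_on lam {1..4}"
    and img: "lam ` {1..4} = {x. x^4 - x^3 - x^2 - x - 1 = 0}"
    using assms by (auto simp: tetranacci_roots_def bij_betw_def)
  have neq: "lam i \<noteq> lam j" if "i \<in> {1..4}" "j \<in> {1..4}" "i \<noteq> j" for i j
    using inj that by (auto dest: inj_onD)
  have root: "lam i ^ 4 - lam i ^ 3 - lam i ^ 2 - lam i - 1 = 0" if "i \<in> {1..4}" for i
    using img that by blast
  have neqs: "lam 1 \<noteq> lam 2" "lam 1 \<noteq> lam 3" "lam 1 \<noteq> lam 4"
    "lam 2 \<noteq> lam 3" "lam 2 \<noteq> lam 4" "lam 3 \<noteq> lam 4"
    by (rule neq; simp)+
  have roots: "lam 1 ^ 4 - lam 1 ^ 3 - lam 1 ^ 2 - lam 1 - 1 = 0"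
    "lam 2 ^ 4 - lam 2 ^ 3 - lam 2 ^ 2 - lam 2 - 1 = 0"
    "lam 3 ^ 4 - lam 3 ^ 3 - lam 3 ^ 2 - lam 3 - 1 = 0"
    "lam 4 ^ 4 - lam 4 ^ 3 - lam 4 ^ 2 - lam 4 - 1 = 0"
    by (rule root; simp)+
  show "lam 1 + lam 2 + lam 3 + lam 4 = 1"
    and "lam 1*lam 2 + lam 1*lam 3 + lam 1*lam 4 + lam 2*lam 3 + lam 2*lam 4 + lam 3*lam 4 = -1"
    and "lam 1*lam 2*lam 3 + lam 1*lam 2*lam 4 + lam 1*lam 3*lam 4 + lam 2*lam 3*lam 4 = 1"
    and "lam 1*lam 2*lam 3*lam 4 = -1"
    by (fact vieta[OF neqs roots])+
qed

text \<open>For a root \<open>x\<close> of \<open>f = x\<^sup>4 - x\<^sup>3 - x\<^sup>2 - x - 1\<close> one has \<open>-x\<^sup>3 + 6x - 1 = f'(x) / x\<^sup>2\<close>, and the product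
  of the roots is \<open>-1\<close>; so the product over the roots is the discriminant \<open>-563\<close> of \<open>f\<close>. It is
  computed here by splitting the roots into two pairs, with sums \<open>u\<close>, \<open>s\<close> and products
  \<open>v\<close>, \<open>p\<close>: each pair contributes a polynomial in its sum and product, and Vieta's formulas
  relate these four quantities.\<close>
lemma prod_denominators:
  fixes a b c d :: complex
  assumes "a + b + c + d = 1" "a*b + a*c + a*d + b*c + b*d + c*d = -1"
    "a*b*c + a*b*d + a*c*d + b*c*d = 1" "a*b*c*d = -1"
  shows "(-(a^3) + 6*a - 1) * (-(b^3) + 6*b - 1) * (-(c^3) + 6*c - 1) * (-(d^3) + 6*d - 1) = -563"
proof -
  define u v s p where "u = a + b" and "v = a * b" and "s = c + d" and "p = c * d"
  note defs = u_def v_def s_def p_def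
  have rels: "s = 1 - u" "p = -1 - v - u * s" "v * s + p * u = 1" "v * p = -1"
    using assms unfolding defs by algebra+
  have pair: "(-(x^3) + 6*x - 1) * (-(y^3) + 6*y - 1) =
      (x*y)^3 - 6 * (x*y) * ((x+y)^2 - 2 * (x*y)) + ((x+y)^3 - 3 * (x+y) * (x*y))
        + 36 * (x*y) - 6 * (x+y) + 1" for x y :: complex
    by algebra
  have "(v^3 - 6 * v * (u^2 - 2 * v) + (u^3 - 3 * u * v) + 36 * v - 6 * u + 1) *
      (p^3 - 6 * p * (s^2 - 2 * p) + (s^3 - 3 * s * p) + 36 * p - 6 * s + 1) = -563"
    using rels by algebra
  then have "((-(a^3) + 6*a - 1) * (-(b^3) + 6*b - 1)) * ((-(c^3) + 6*c - 1) * (-(d^3) + 6*d - 1)) = -563"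
    unfolding pair defs .
  then show ?thesis by (simp only: mult.assoc)
qed

lemma prod_cf:
  assumes "tetranacci_roots lam"
  shows "cf lam 1 * cf lam 2 * cf lam 3 * cf lam 4 = - 1 / 563"
proof -
  have "cf lam 1 * cf lam 2 * cf lam 3 * cf lam 4 =
      1 / ((-(lam 1^3) + 6*lam 1 - 1) * (-(lam 2^3) + 6*lam 2 - 1) *
           (-(lam 3^3) + 6*lam 3 - 1) * (-(lam 4^3) + 6*lam 4 - 1))"
    by (simp only: cf_def times_divide_times_eq mult_1_left)
  also have "\<dots> = - 1 / 563"
    by (simp only: prod_denominators[OF root_relations[OF assms]]) simp
  finally show ?thesis .
qed

section \<open>Generating functions as symmetric functions\<close>

definition root_term :: "(nat \<Rightarrow> complex) \<Rightarrow> nat \<Rightarrow> nat \<Rightarrow> complex fps" where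
  "root_term lam n i = fps_const (cf lam i ^ n) * fps_exp (lam i)"

lemma egf_coeff_exp_sum:
  "egf_coeff (\<Sum>i\<in>X. fps_const (w i) * fps_exp (s * b i)) k
     = s ^ k * egf_coeff (\<Sum>i\<in>X. fps_const (w i) * fps_exp (b i)) k"
  by (simp add: egf_coeff_def fps_sum_nth power_mult_distrib sum_distrib_left mult_ac)

lemma egf_coeff_power_sum:
  "egf_coeff (\<Sum>i=1..4. root_term lam n i ^ r) k = of_nat r ^ k * egf_coeff (gf1 lam (r * n)) k"
proof -
  have "root_term lam n i ^ r = fps_const (cf lam i ^ (r * n)) * fps_exp (of_nat r * lam i)" for i
    by (simp add: root_term_def power_mult_distrib fps_exp_power_mult flip: power_mult)
      (simp add: mult.commute)
  then show ?thesis
    by (simp only: gf1_def egf_coeff_exp_sum)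
qed

lemma sum_1_4:
  fixes f :: "nat \<Rightarrow> 'a::comm_monoid_add"
  shows "(\<Sum>i=1..4. f i) = f 1 + f 2 + f 3 + f 4"
  by (simp add: numeral_eq_Suc add.assoc)

lemma triples: "{(i, j, l). 1 \<le> i \<and> i < j \<and> j < l \<and> l \<le> (4::nat)}
  = {(1, 2, 3), (1, 2, 4), (1, 3, 4), (2, 3, 4)}"
  by auto

lemma t2_eq:
  fixes lam n
  defines "a \<equiv> root_term lam n"
  shows "t2 lam n k = egf_coeff
    (a 1 * a 2 * a 3 * (a 1 + a 2 + a 3) + a 1 * a 2 * a 4 * (a 1 + a 2 + a 4)
     + a 1 * a 3 * a 4 * (a 1 + a 3 + a 4) + a 2 * a 3 * a 4 * (a 2 + a 3 + a 4)) k"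
  unfolding t2_def triples a_def root_term_def
  by (simp add: fps_exp_add_mult add.assoc mult_ac flip: fps_const_mult)

lemma t5_eq:
  fixes lam n
  defines "a \<equiv> root_term lam n"
  shows "t5 lam n k = egf_coeff
    (a 1 * a 2 * a 3 * (a 1 + a 2 + a 3)^2 + a 1 * a 2 * a 4 * (a 1 + a 2 + a 4)^2
     + a 1 * a 3 * a 4 * (a 1 + a 3 + a 4)^2 + a 2 * a 3 * a 4 * (a 2 + a 3 + a 4)^2) k"
  unfolding t5_def triples a_def root_term_def
  by (simp add: fps_exp_add_mult add.assoc mult_ac flip: fps_const_mult)

text \<open>The sum on the left is \<open>gf2 lam n\<close> with \<open>x\<close> replaced by \<open>-x\<close>. As the four roots add up to 1, the
  factor \<open>e\<^sup>x\<close> turns \<open>e\<^bsup>-\<lambda>\<^sub>i x\<^esup>\<close> into the product of the other three exponentials.\<close>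
lemma elementary3_eq:
  fixes lam n
  defines "a \<equiv> root_term lam n"
  assumes "tetranacci_roots lam"
  shows "(\<Sum>i=1..4. fps_const (\<Prod>j\<in>{1..4} - {i}. cf lam j ^ n) * fps_exp (-1 * lam i)) * fps_exp 1
    = a 1 * a 2 * a 3 + a 1 * a 2 * a 4 + a 1 * a 3 * a 4 + a 2 * a 3 * a 4"
proof -
  have minus: "{1..4} - {1::nat} = {2, 3, 4}" "{1..4} - {2::nat} = {1, 3, 4}"
    "{1..4} - {3::nat} = {1, 2, 4}" "{1..4} - {4::nat} = {1, 2, 3}"
    by auto
  have "fps_exp (-1 * lam i) * fps_exp 1 = fps_exp (x + y + z)"
    if "lam i + x + y + z = 1" for i x y z
  proof -
    have "x + y + z = -1 * lam i + 1" using that by algebra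
    then show ?thesis by (simp only: fps_exp_add_mult)
  qed
  note exps = this[of 1 "lam 2" "lam 3" "lam 4"] this[of 2 "lam 1" "lam 3" "lam 4"]
    this[of 3 "lam 1" "lam 2" "lam 4"] this[of 4 "lam 1" "lam 2" "lam 3"]
  have sums: "lam 1 + lam 2 + lam 3 + lam 4 = 1" "lam 2 + lam 1 + lam 3 + lam 4 = 1"
    "lam 3 + lam 1 + lam 2 + lam 4 = 1" "lam 4 + lam 1 + lam 2 + lam 3 = 1"
    using root_relations(1)[OF assms(2)] by (simp_all add: add_ac)
  show ?thesis
    unfolding sum_1_4 minus distrib_right mult.assoc[of "fps_const _"] exps(1)[OF sums(1)]
      exps(2)[OF sums(2)] exps(3)[OF sums(3)] exps(4)[OF sums(4)] a_def root_term_def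
    by (simp add: fps_exp_add_mult mult_ac add_ac flip: fps_const_mult)
qed

lemma elementary4_eq:
  fixes lam n
  defines "a \<equiv> root_term lam n"
  assumes "tetranacci_roots lam"
  shows "a 1 * a 2 * a 3 * a 4 = fps_const ((-1 / 563) ^ n) * fps_exp 1"
proof -
  have "a 1 * a 2 * a 3 * a 4 = fps_const ((cf lam 1 * cf lam 2 * cf lam 3 * cf lam 4) ^ n)
      * fps_exp (lam 1 + lam 2 + lam 3 + lam 4)"
    by (simp add: a_def root_term_def fps_exp_add_mult power_mult_distrib mult_ac
        flip: fps_const_mult)
  then show ?thesis
    by (simp only: prod_cf[OF assms(2)] root_relations(1)[OF assms(2)])
qed

section \<open>The symmetric function identity\<close>

text \<open>In the last two cases, the bracket is \<open>q\<close> minus the variable that is missing from the monomial in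
  front of it, and that monomial times the missing variable is \<open>e4\<close>.\<close>
lemma newton_identities:
  fixes a b c d :: "'a::idom"
  assumes "q = a + b + c + d" "e2 = a*b + a*c + a*d + b*c + b*d + c*d"
   "e3 = a*b*c + a*b*d + a*c*d + b*c*d" "e4 = a*b*c*d"
  shows "a^2+b^2+c^2+d^2 = q^2 - 2*e2"
    and "a^3+b^3+c^3+d^3 = q^3 - 3*q*e2 + 3*e3"
    and "a^4+b^4+c^4+d^4 = q^4 - 4*q^2*e2 + 2*e2^2 + 4*q*e3 - 4*e4"
    and "a^5+b^5+c^5+d^5 = q^5 - 5*q^3*e2 + 5*q*e2^2 + 5*q^2*e3 - 5*e2*e3 - 5*q*e4"
    and "a*b*c*(a+b+c) + a*b*d*(a+b+d) + a*c*d*(a+c+d) + b*c*d*(b+c+d) = q*e3 - 4*e4"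
    and "a*b*c*(a+b+c)^2 + a*b*d*(a+b+d)^2 + a*c*d*(a+c+d)^2 + b*c*d*(b+c+d)^2 = q^2*e3 - 7*q*e4"
  unfolding assms by algebra+

text \<open>The six free monomials are \<open>q\<^sup>5\<close>, \<open>q\<^sup>3 e2\<close>, \<open>q e2\<^sup>2\<close>, \<open>q\<^sup>2 e3\<close>, \<open>e2 e3\<close> and \<open>q e4\<close>; comparing their
  coefficients on both sides gives six linear equations, which determine \<open>A\<close>, \<open>D\<close>, \<open>E\<close>, \<open>F\<close>,
  \<open>H\<close> and \<open>K\<close> in terms of the ten free parameters.\<close>
lemma symmetric_identity:
  fixes q e2 e3 e4 :: "'a::idom"
  assumes "p2 = q^2 - 2*e2"
    and "p3 = q^3 - 3*q*e2 + 3*e3"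
    and "p4 = q^4 - 4*q^2*e2 + 2*e2^2 + 4*q*e3 - 4*e4"
    and "p5 = q^5 - 5*q^3*e2 + 5*q*e2^2 + 5*q^2*e3 - 5*e2*e3 - 5*q*e4"
    and "T2 = q*e3 - 4*e4" and "T5 = q^2*e3 - 7*q*e4"
    and A: "A = I + 2 * L + 2 * N + P + 2 * Q + 6 * R + 4 * S - 14"
    and D: "D = - G - I - J - 2 * L - M - 2 * P - 3 * Q - 6 * R - 7 * S + 20"
    and E: "E = - I - 2 * L - N - Q - 3 * R - S + 5"
    and F: "F = - 3 * G - 6 * I - 7 * J - 7 * M + 6 * N - 12 * L - 9 * P - 15 * Q
                - 24 * R - 33 * S + 90"
    and H: "H = - L - 2 * N - P - Q - 4 * R - 3 * S + 10"
    and K: "K = 2 * I + 2 * J - 2 * N + 4 * L - P + 4 * Q + 6 * R + 2 * S - 10"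
  shows "D * T5 = q^5 - A*p5 - E*(q*p4) - F*(e4*q) - G*(T2*q) - H*(p2*p3) - I*(p3*e2)
    - J*(e3*p2) - K*(e3*e2) - L*(p3*q*q) - M*(e3*q*q) - N*(p2*p2*q) - P*(e2*e2*q)
    - Q*(p2*e2*q) - R*(p2*q*q*q) - S*(e2*q*q*q)"
  unfolding assms by algebra

theorem theorem19:
  fixes lam :: "nat \<Rightarrow> complex"
    and A1 A2 :: "nat \<Rightarrow> rat"
    and U V :: "nat \<Rightarrow> nat \<Rightarrow> int"
    and G I J L M N P Q R S A D E F H K :: complex
    and m n :: nat
  assumes roots: "tetranacci_roots lam"
    and U: "\<And>r. r \<ge> 1 \<Longrightarrow> primitive_tetranacci_rep (gf1 lam r) (A1 r) (U r)"
    and V: "\<And>r. r \<ge> 1 \<Longrightarrow> primitive_tetranacci_rep (gf2 lam r) (A2 r) (V r)"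
    and A: "A = I + 2 * L + 2 * N + P + 2 * Q + 6 * R + 4 * S - 14"
    and D: "D = - G - I - J - 2 * L - M - 2 * P - 3 * Q - 6 * R - 7 * S + 20"
    and E: "E = - I - 2 * L - N - Q - 3 * R - S + 5"
    and F: "F = - 3 * G - 6 * I - 7 * J - 7 * M + 6 * N - 12 * L - 9 * P - 15 * Q
                - 24 * R - 33 * S + 90"
    and H: "H = - L - 2 * N - P - Q - 4 * R - 3 * S + 10"
    and K: "K = 2 * I + 2 * J - 2 * N + 4 * L - P + 4 * Q + 6 * R + 2 * S - 10"
    and D_nz: "D \<noteq> 0"
    and n: "n \<ge> 1"
  shows "D * t5 lam n m =
      1 / of_rat (A1 n) ^ 5 *
        (\<Sum>(k1, k2, k3, k4, k5) \<in> {(k1, k2, k3, k4, k5). k1 + k2 + k3 + k4 + k5 = m}.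
           multinomial m [k1, k2, k3, k4, k5] * of_int (U n k1) * of_int (U n k2)
             * of_int (U n k3) * of_int (U n k4) * of_int (U n k5))
    - A / of_rat (A1 (5 * n)) * 5 ^ m * of_int (U (5 * n) m)
    - E / (of_rat (A1 (4 * n)) * of_rat (A1 n)) *
        (\<Sum>k=0..m. of_nat (m choose k) * 4 ^ (m - k) * of_int (U (4 * n) (m - k)) * of_int (U n k))
    - F / of_rat (A1 n) * (-1 / 563) ^ n *
        (\<Sum>k=0..m. of_nat (m choose k) * of_int (U n k))
    - G / of_rat (A1 n) *
        (\<Sum>k=0..m. of_nat (m choose k) * t2 lam n k * of_int (U n (m - k)))
    - H / (of_rat (A1 (3 * n)) * of_rat (A1 (2 * n))) *
        (\<Sum>k=0..m. of_nat (m choose k) * 3 ^ (m - k) * 2 ^ k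
           * of_int (U (3 * n) (m - k)) * of_int (U (2 * n) k))
    - I / of_rat (A1 (3 * n)) *
        (\<Sum>k=0..m. of_nat (m choose k) * 3 ^ k * of_int (U (3 * n) k) * t1 A1 U n (m - k))
    - J / (of_rat (A2 n) * of_rat (A1 (2 * n))) *
        (\<Sum>(k1, k2, k3) \<in> {(k1, k2, k3). k1 + k2 + k3 = m}.
           multinomial m [k1, k2, k3] * (-1) ^ k1 * of_int (V n k1)
             * 2 ^ k2 * of_int (U (2 * n) k2))
    - K / of_rat (A2 n) *
        (\<Sum>(k1, k2, k3) \<in> {(k1, k2, k3). k1 + k2 + k3 = m}.
           multinomial m [k1, k2, k3] * (-1) ^ k1 * of_int (V n k1) * t1 A1 U n k2)
    - L / (of_rat (A1 (3 * n)) * of_rat (A1 n) ^ 2) *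
        (\<Sum>(k1, k2, k3) \<in> {(k1, k2, k3). k1 + k2 + k3 = m}.
           multinomial m [k1, k2, k3] * 3 ^ k1 * of_int (U (3 * n) k1)
             * of_int (U n k2) * of_int (U n k3))
    - M / (of_rat (A2 n) * of_rat (A1 n) ^ 2) *
        (\<Sum>(k1, k2, k3, k4) \<in> {(k1, k2, k3, k4). k1 + k2 + k3 + k4 = m}.
           multinomial m [k1, k2, k3, k4] * (-1) ^ k1 * of_int (V n k1)
             * of_int (U n k2) * of_int (U n k3))
    - N / (of_rat (A1 (2 * n)) ^ 2 * of_rat (A1 n)) *
        (\<Sum>(k1, k2, k3) \<in> {(k1, k2, k3). k1 + k2 + k3 = m}.
           multinomial m [k1, k2, k3] * 2 ^ k1 * of_int (U (2 * n) k1)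
             * 2 ^ k2 * of_int (U (2 * n) k2) * of_int (U n k3))
    - P / of_rat (A1 n) *
        (\<Sum>(k1, k2, k3) \<in> {(k1, k2, k3). k1 + k2 + k3 = m}.
           multinomial m [k1, k2, k3] * t1 A1 U n k1 * t1 A1 U n k2 * of_int (U n k3))
    - Q / (of_rat (A1 (2 * n)) * of_rat (A1 n)) *
        (\<Sum>(k1, k2, k3) \<in> {(k1, k2, k3). k1 + k2 + k3 = m}.
           multinomial m [k1, k2, k3] * 2 ^ k1 * of_int (U (2 * n) k1)
             * t1 A1 U n k2 * of_int (U n k3))
    - R / (of_rat (A1 (2 * n)) * of_rat (A1 n) ^ 3) *
        (\<Sum>(k1, k2, k3, k4) \<in> {(k1, k2, k3, k4). k1 + k2 + k3 + k4 = m}.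
           multinomial m [k1, k2, k3, k4] * 2 ^ k1 * of_int (U (2 * n) k1)
             * of_int (U n k2) * of_int (U n k3) * of_int (U n k4))
    - S / of_rat (A1 n) ^ 3 *
        (\<Sum>(k1, k2, k3, k4) \<in> {(k1, k2, k3, k4). k1 + k2 + k3 + k4 = m}.
           multinomial m [k1, k2, k3, k4] * t1 A1 U n k1
             * of_int (U n k2) * of_int (U n k3) * of_int (U n k4))"
proof -
  define a where "a = root_term lam n"
  define p where "p r = (\<Sum>i=1..4. a i ^ r)" for r
  define q where "q = p 1"
  define e2 where "e2 = a 1*a 2 + a 1*a 3 + a 1*a 4 + a 2*a 3 + a 2*a 4 + a 3*a 4"
  define e3 where "e3 = a 1*a 2*a 3 + a 1*a 2*a 4 + a 1*a 3*a 4 + a 2*a 3*a 4"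
  define e4 where "e4 = a 1*a 2*a 3*a 4"
  define T2 where "T2 = a 1*a 2*a 3*(a 1+a 2+a 3) + a 1*a 2*a 4*(a 1+a 2+a 4)
    + a 1*a 3*a 4*(a 1+a 3+a 4) + a 2*a 3*a 4*(a 2+a 3+a 4)"
  define T5 where "T5 = a 1*a 2*a 3*(a 1+a 2+a 3)^2 + a 1*a 2*a 4*(a 1+a 2+a 4)^2
    + a 1*a 3*a 4*(a 1+a 3+a 4)^2 + a 2*a 3*a 4*(a 2+a 3+a 4)^2"
  define W where "W = (\<Sum>i=1..4. fps_const (\<Prod>j\<in>{1..4} - {i}. cf lam j ^ n) * fps_exp (-1 * lam i))"

  have q_eq: "q = a 1 + a 2 + a 3 + a 4"
    unfolding q_def p_def power_one_right by (rule sum_1_4)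
  have p_eq: "p r = a 1 ^ r + a 2 ^ r + a 3 ^ r + a 4 ^ r" for r
    unfolding p_def by (rule sum_1_4)
  note newton = newton_identities[OF q_eq e2_def e3_def e4_def]

  have p_coeff: "egf_coeff (p r) k = of_nat r ^ k * of_int (U (r * n) k) / of_rat (A1 (r * n))"
    if "r \<ge> 1" for r k
  proof -
    have "r * n \<ge> 1" using that n by simp
    then show ?thesis
      by (simp only: p_def a_def egf_coeff_power_sum egf_coeff_rep[OF U] times_divide_eq_right)
  qed
  have q_coeff: "egf_coeff q k = of_int (U n k) / of_rat (A1 n)" for k
    using p_coeff[of 1 k] by (simp add: q_def)
  have e2_coeff: "egf_coeff e2 k = t1 A1 U n k" for k
  proof -
    have "e2 = fps_const (1/2) * (q * q - p 2)"
    proof -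
      have "q * q - p 2 = fps_const 2 * e2"
        unfolding p_eq newton(1) by (simp add: power2_eq_square fps_numeral_fps_const)
      then show ?thesis by (simp add: mult.assoc[symmetric])
    qed
    then have "egf_coeff e2 k = 1/2 * (egf_coeff (q * q) k - egf_coeff (p 2) k)"
      by (simp only: egf_coeff_linear)
    then show ?thesis
      by (simp add: t1_def egf_coeff_mult2 q_coeff p_coeff sum_distrib_left power2_eq_square
          mult_ac)
  qed
  have W_coeff: "egf_coeff W k = (-1) ^ k * of_int (V n k) / of_rat (A2 n)" for k
    using egf_coeff_rep[OF V[OF n], of k] unfolding W_def egf_coeff_exp_sum gf2_def by simp
  have exp_coeff: "egf_coeff (fps_exp 1) k = 1" for k
    by (simp add: egf_coeff_def)
  have e3_eq: "e3 = W * fps_exp 1"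
    unfolding e3_def W_def a_def by (rule elementary3_eq[OF roots, symmetric])
  have e4_eq: "e4 = fps_const ((-1 / 563) ^ n) * fps_exp 1"
    unfolding e4_def a_def by (rule elementary4_eq[OF roots])
  have T2_coeff: "egf_coeff T2 k = t2 lam n k" for k
    unfolding T2_def a_def by (rule t2_eq[symmetric])
  have T5_coeff: "egf_coeff T5 k = t5 lam n k" for k
    unfolding T5_def a_def by (rule t5_eq[symmetric])
  note coeffs = q_coeff p_coeff e2_coeff W_coeff exp_coeff T2_coeff

  have "fps_const D * T5 = q^5 - fps_const A * p 5 - fps_const E * (q * p 4)
      - fps_const F * (e4 * q) - fps_const G * (T2 * q) - fps_const H * (p 2 * p 3)
      - fps_const I * (p 3 * e2) - fps_const J * (e3 * p 2) - fps_const K * (e3 * e2)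
      - fps_const L * (p 3 * q * q) - fps_const M * (e3 * q * q) - fps_const N * (p 2 * p 2 * q)
      - fps_const P * (e2 * e2 * q) - fps_const Q * (p 2 * e2 * q)
      - fps_const R * (p 2 * q * q * q) - fps_const S * (e2 * q * q * q)"
    by (rule symmetric_identity)
      (simp_all only: newton p_eq T2_def T5_def A D E F H K fps_numeral_fps_const
        fps_const_add fps_const_mult fps_const_sub fps_const_neg)
  from arg_cong[OF this, of "\<lambda>f. egf_coeff f m"]
  have main: "D * t5 lam n m = egf_coeff (q^5) m - A * egf_coeff (p 5) m - E * egf_coeff (q * p 4) m
      - F * egf_coeff (e4 * q) m - G * egf_coeff (T2 * q) m - H * egf_coeff (p 2 * p 3) m
      - I * egf_coeff (p 3 * e2) m - J * egf_coeff (e3 * p 2) m - K * egf_coeff (e3 * e2) m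
      - L * egf_coeff (p 3 * q * q) m - M * egf_coeff (e3 * q * q) m
      - N * egf_coeff (p 2 * p 2 * q) m - P * egf_coeff (e2 * e2 * q) m
      - Q * egf_coeff (p 2 * e2 * q) m - R * egf_coeff (p 2 * q * q * q) m
      - S * egf_coeff (e2 * q * q * q) m"
    by (simp only: egf_coeff_linear T5_coeff)

  \<comment> \<open>The factor \<open>fps_exp 1\<close> of \<open>e3\<close> is moved to the end, where its constant coefficients account
    for the index that occurs in the multinomial coefficient only.\<close>
  have e3_last: "e3 * p 2 = W * p 2 * fps_exp 1" "e3 * e2 = W * e2 * fps_exp 1"
    "e3 * q * q = W * q * q * fps_exp 1"
    unfolding e3_eq by (simp_all only: mult_ac)
  have e4q: "e4 * q = fps_const ((-1 / 563) ^ n) * (q * fps_exp 1)"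
    unfolding e4_eq by (simp only: mult_ac)
  have q5: "q^5 = q * q * q * q * q"
    by (simp add: eval_nat_numeral mult.assoc)
  have term_power: "egf_coeff (q^5) m =
      1 / of_rat (A1 n) ^ 5 *
      (\<Sum>(k1, k2, k3, k4, k5) \<in> {(k1, k2, k3, k4, k5). k1 + k2 + k3 + k4 + k5 = m}.
      multinomial m [k1, k2, k3, k4, k5] * of_int (U n k1) * of_int (U n k2)
      * of_int (U n k3) * of_int (U n k4) * of_int (U n k5))"
    unfolding q5 egf_coeff_mult5 sum_distrib_left
    by (intro sum.cong refl) (auto simp: coeffs power_numeral_reduce divide_inverse mult_ac)
  have term_A: "A * egf_coeff (p 5) m =
      A / of_rat (A1 (5 * n)) * 5 ^ m * of_int (U (5 * n) m)"
    by (simp add: p_coeff)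
  have term_E: "E * egf_coeff (q * p 4) m =
      E / (of_rat (A1 (4 * n)) * of_rat (A1 n)) *
      (\<Sum>k=0..m. of_nat (m choose k) * 4 ^ (m - k) * of_int (U (4 * n) (m - k)) * of_int (U n k))"
    unfolding egf_coeff_mult2 sum_distrib_left
    by (intro sum.cong refl) (auto simp: coeffs power_numeral_reduce divide_inverse mult_ac)
  have term_F: "F * egf_coeff (e4 * q) m =
      F / of_rat (A1 n) * (-1 / 563) ^ n *
      (\<Sum>k=0..m. of_nat (m choose k) * of_int (U n k))"
    unfolding e4q egf_coeff_linear(3)
    unfolding egf_coeff_mult2 sum_distrib_left
    by (intro sum.cong refl) (simp add: coeffs mult_ac)
  have term_G: "G * egf_coeff (T2 * q) m =
      G / of_rat (A1 n) *
      (\<Sum>k=0..m. of_nat (m choose k) * t2 lam n k * of_int (U n (m - k)))"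
    unfolding egf_coeff_mult2 sum_distrib_left
    by (intro sum.cong refl) (auto simp: coeffs power_numeral_reduce divide_inverse mult_ac)
  have term_H: "H * egf_coeff (p 2 * p 3) m =
      H / (of_rat (A1 (3 * n)) * of_rat (A1 (2 * n))) *
      (\<Sum>k=0..m. of_nat (m choose k) * 3 ^ (m - k) * 2 ^ k
      * of_int (U (3 * n) (m - k)) * of_int (U (2 * n) k))"
    unfolding egf_coeff_mult2 sum_distrib_left
    by (intro sum.cong refl) (auto simp: coeffs power_numeral_reduce divide_inverse mult_ac)
  have term_I: "I * egf_coeff (p 3 * e2) m =
      I / of_rat (A1 (3 * n)) *
      (\<Sum>k=0..m. of_nat (m choose k) * 3 ^ k * of_int (U (3 * n) k) * t1 A1 U n (m - k))"
    unfolding egf_coeff_mult2 sum_distrib_left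
    by (intro sum.cong refl) (auto simp: coeffs power_numeral_reduce divide_inverse mult_ac)
  have term_J: "J * egf_coeff (e3 * p 2) m =
      J / (of_rat (A2 n) * of_rat (A1 (2 * n))) *
      (\<Sum>(k1, k2, k3) \<in> {(k1, k2, k3). k1 + k2 + k3 = m}.
      multinomial m [k1, k2, k3] * (-1) ^ k1 * of_int (V n k1)
      * 2 ^ k2 * of_int (U (2 * n) k2))"
    unfolding e3_last egf_coeff_mult3 sum_distrib_left
    by (intro sum.cong refl) (auto simp: coeffs power_numeral_reduce divide_inverse mult_ac)
  have term_K: "K * egf_coeff (e3 * e2) m =
      K / of_rat (A2 n) *
      (\<Sum>(k1, k2, k3) \<in> {(k1, k2, k3). k1 + k2 + k3 = m}.
      multinomial m [k1, k2, k3] * (-1) ^ k1 * of_int (V n k1) * t1 A1 U n k2)"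
    unfolding e3_last egf_coeff_mult3 sum_distrib_left
    by (intro sum.cong refl) (auto simp: coeffs power_numeral_reduce divide_inverse mult_ac)
  have term_L: "L * egf_coeff (p 3 * q * q) m =
      L / (of_rat (A1 (3 * n)) * of_rat (A1 n) ^ 2) *
      (\<Sum>(k1, k2, k3) \<in> {(k1, k2, k3). k1 + k2 + k3 = m}.
      multinomial m [k1, k2, k3] * 3 ^ k1 * of_int (U (3 * n) k1)
      * of_int (U n k2) * of_int (U n k3))"
    unfolding egf_coeff_mult3 sum_distrib_left
    by (intro sum.cong refl) (auto simp: coeffs power_numeral_reduce divide_inverse mult_ac)
  have term_M: "M * egf_coeff (e3 * q * q) m =
      M / (of_rat (A2 n) * of_rat (A1 n) ^ 2) *
      (\<Sum>(k1, k2, k3, k4) \<in> {(k1, k2, k3, k4). k1 + k2 + k3 + k4 = m}.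
      multinomial m [k1, k2, k3, k4] * (-1) ^ k1 * of_int (V n k1)
      * of_int (U n k2) * of_int (U n k3))"
    unfolding e3_last egf_coeff_mult4 sum_distrib_left
    by (intro sum.cong refl) (auto simp: coeffs power_numeral_reduce divide_inverse mult_ac)
  have term_N: "N * egf_coeff (p 2 * p 2 * q) m =
      N / (of_rat (A1 (2 * n)) ^ 2 * of_rat (A1 n)) *
      (\<Sum>(k1, k2, k3) \<in> {(k1, k2, k3). k1 + k2 + k3 = m}.
      multinomial m [k1, k2, k3] * 2 ^ k1 * of_int (U (2 * n) k1)
      * 2 ^ k2 * of_int (U (2 * n) k2) * of_int (U n k3))"
    unfolding egf_coeff_mult3 sum_distrib_left
    by (intro sum.cong refl) (auto simp: coeffs power_numeral_reduce divide_inverse mult_ac)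
  have term_P: "P * egf_coeff (e2 * e2 * q) m =
      P / of_rat (A1 n) *
      (\<Sum>(k1, k2, k3) \<in> {(k1, k2, k3). k1 + k2 + k3 = m}.
      multinomial m [k1, k2, k3] * t1 A1 U n k1 * t1 A1 U n k2 * of_int (U n k3))"
    unfolding egf_coeff_mult3 sum_distrib_left
    by (intro sum.cong refl) (auto simp: coeffs power_numeral_reduce divide_inverse mult_ac)
  have term_Q: "Q * egf_coeff (p 2 * e2 * q) m =
      Q / (of_rat (A1 (2 * n)) * of_rat (A1 n)) *
      (\<Sum>(k1, k2, k3) \<in> {(k1, k2, k3). k1 + k2 + k3 = m}.
      multinomial m [k1, k2, k3] * 2 ^ k1 * of_int (U (2 * n) k1)
      * t1 A1 U n k2 * of_int (U n k3))"
    unfolding egf_coeff_mult3 sum_distrib_left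
    by (intro sum.cong refl) (auto simp: coeffs power_numeral_reduce divide_inverse mult_ac)
  have term_R: "R * egf_coeff (p 2 * q * q * q) m =
      R / (of_rat (A1 (2 * n)) * of_rat (A1 n) ^ 3) *
      (\<Sum>(k1, k2, k3, k4) \<in> {(k1, k2, k3, k4). k1 + k2 + k3 + k4 = m}.
      multinomial m [k1, k2, k3, k4] * 2 ^ k1 * of_int (U (2 * n) k1)
      * of_int (U n k2) * of_int (U n k3) * of_int (U n k4))"
    unfolding egf_coeff_mult4 sum_distrib_left
    by (intro sum.cong refl) (auto simp: coeffs power_numeral_reduce divide_inverse mult_ac)
  have term_S: "S * egf_coeff (e2 * q * q * q) m =
      S / of_rat (A1 n) ^ 3 *
      (\<Sum>(k1, k2, k3, k4) \<in> {(k1, k2, k3, k4). k1 + k2 + k3 + k4 = m}.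
      multinomial m [k1, k2, k3, k4] * t1 A1 U n k1
      * of_int (U n k2) * of_int (U n k3) * of_int (U n k4))"
    unfolding egf_coeff_mult4 sum_distrib_left
    by (intro sum.cong refl) (auto simp: coeffs power_numeral_reduce divide_inverse mult_ac)
  show ?thesis
    unfolding main
      term_power term_A term_E term_F term_G term_H
      term_I term_J term_K term_L term_M term_N term_P
      term_Q term_R term_S ..
qed

end
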